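(* Let $n>2$ be an integer. There are no positive integers $x,y,z$ with $x>y$ and $$ y < \frac{1}{\sqrt[n]{2}-1} $$ such that $x^n+y^n=z^n$. *)

theory Defs
  imports Complex_Main
begin

end

theory Submission
  imports Defs
begin

text \<open>
  The bound on \<open>y\<close> says \<open>2 y\<^sup>n < (y + 1)\<^sup>n\<close>. The gap \<open>(t + 1)\<^sup>n - t\<^sup>n\<close> is nondecreasing in \<open>t\<close>, so
  \<open>z \<ge> x + 1\<close> forces \<open>y\<^sup>n = z\<^sup>n - x\<^sup>n \<ge> (x + 1)\<^sup>n - x\<^sup>n \<ge> (y + 1)\<^sup>n - y\<^sup>n > y\<^sup>n\<close>.
\<close>

lemma Suc_power_eq_sum:
  "Suc t ^ n = (\<Sum>k<n. (n choose k) * t ^ k) + t ^ n"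
  using binomial[of t 1 n] by (simp add: lessThan_Suc_atMost[symmetric])

text \<open>By the binomial expansion, \<open>Suc t ^ n - t ^ n\<close> is a polynomial in
  \<open>t\<close> with nonnegative coefficients. The additive form avoids truncated
  subtraction.\<close>

lemma Suc_power_gap_mono:
  assumes "y \<le> x"
  shows "Suc y ^ n + x ^ n \<le> Suc x ^ n + y ^ n"
proof -
  have "(\<Sum>k<n. (n choose k) * y ^ k) \<le> (\<Sum>k<n. (n choose k) * x ^ k)"
    by (intro sum_mono mult_left_mono power_mono assms) auto
  then show ?thesis
    by (simp add: Suc_power_eq_sum)
qed

text \<open>Multiplying the bound by \<open>root n 2 - 1\<close>, which is positive, gives
  \<open>root n 2 * y < y + 1\<close>; then take \<open>n\<close>-th powers.\<close>

lemma two_mult_power_less: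
  fixes n y :: nat
  assumes "n > 0" and "real y < 1 / (root n 2 - 1)"
  shows "2 * y ^ n < Suc y ^ n"
proof -
  have "root n 2 > 1"
    using assms(1) by simp
  then have "root n 2 * real y < real (Suc y)"
    using assms(2) by (simp add: field_simps)
  then have "(root n 2 * real y) ^ n < real (Suc y) ^ n"
    using assms(1) by (intro power_strict_mono) auto
  then have "real (2 * y ^ n) < real (Suc y ^ n)"
    using assms(1) by (simp add: power_mult_distrib)
  then show ?thesis
    by (simp only: of_nat_less_iff)
qed

theorem mainTheorem2:
  fixes n :: nat
  assumes "n > 2"
  shows "\<not> (\<exists>x y z :: nat. x > 0 \<and> y > 0 \<and> z > 0 \<and> x > y \<and>
           real y < 1 / (root n 2 - 1) \<and> x ^ n + y ^ n = z ^ n)"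
proof
  assume "\<exists>x y z :: nat. x > 0 \<and> y > 0 \<and> z > 0 \<and> x > y \<and>
           real y < 1 / (root n 2 - 1) \<and> x ^ n + y ^ n = z ^ n"
  then obtain x y z :: nat where "y > 0" "y < x"
    and bound: "real y < 1 / (root n 2 - 1)" and eq: "x ^ n + y ^ n = z ^ n"
    by blast
  \<comment> \<open>Since \<open>y\<close> is positive, \<open>z\<close> exceeds \<open>x\<close>,
    and by integrality it does so by at least 1.\<close>
  have "x ^ n < z ^ n"
    using \<open>y > 0\<close> by (simp flip: eq)
  then have "Suc x \<le> z"
    using power_less_imp_less_base[of x n z] by simp
  then have "Suc x ^ n \<le> x ^ n + y ^ n"
    unfolding eq by (rule power_mono) simp
  moreover have "Suc y ^ n + x ^ n \<le> Suc x ^ n + y ^ n"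
    using \<open>y < x\<close> by (intro Suc_power_gap_mono) simp
  moreover have "2 * y ^ n < Suc y ^ n"
    using two_mult_power_less[OF _ bound] assms by simp
  ultimately show False
    by linarith
qed

end
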